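(* Let $G$ be a finite group, let $a,b,c$ be non-identity elements of $G$ and let $A=\langle a\rangle$, $B=\langle b\rangle$, $C=\langle c\rangle$. Suppose that $abc=1$, that $|A\cap B|=|A\cap C|=|B\cap C|=1$, and that $G=\langle a,b,c\rangle$. Let $(T^{\circ},T^{\star})$ be the latin bitrade $$T^{\circ}=\{(gA,gB,gC)\mid g\in G\},\qquad T^{\star}=\{(gA,gB,ga^{-1}C)\mid g\in G\}.$$ Then $(T^{\circ},T^{\star})$ is thin (and thus $T^{\circ}$ is minimal) if and only if the only solutions to the equation $a^ib^jc^k=1$ are $(i,j,k)=(0,0,0)$ and $(i,j,k)=(1,1,1)$, where $i$, $j$ and $k$ are calculated modulo $|A|$, $|B|$ and $|C|$, respectively. (That is: thinness is equivalent to the condition on solutions, and when it holds $T^{\circ}$ is a minimal latin trade.)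
   Context: Let $A_1,A_2,A_3$ be finite, non-empty, pairwise disjoint sets (of rows, columns and symbols, respectively). A partial latin square is a subset $T\subseteq A_1\times A_2\times A_3$ such that (P1) if $(a_1,a_2,a_3),(b_1,b_2,b_3)\in T$ then either at most one of $a_1=b_1$, $a_2=b_2$, $a_3=b_3$ is true or all three are true; (P2) every $\alpha\in A_1\cup A_2\cup A_3$ occurs as a coordinate of some element of $T$. A latin bitrade is a pair $(T^{\circ},T^{\star})$ of partial latin squares $T^{\circ},T^{\star}\subset A_1\times A_2\times A_3$ such that (R1) $T^{\circ}\cap T^{\star}=\emptyset$; (R2) for all $(a_1,a_2,a_3)\in T^{\circ}$ and all $r\ne s$ in $\{1,2,3\}$ there is a unique $(b_1,b_2,b_3)\in T^{\star}$ with $a_r=b_r$ and $a_s=b_s$; (R3) the same as (R2) with $T^{\circ}$ and $T^{\star}$ interchanged. $T^{\circ}$ is then called a latin trade. Under the hypotheses of the claim the given pair is a latin bitrade, with $A_1,A_2,A_3$ the sets of left cosets in $G$ of $A,B,C$ respectively. Write $i\circ j=k$ for $(i,j,k)\in T^{\circ}$ and $i\star j=k$ for $(i,j,k)\in T^{\star}$. The latin bitrade $(T^{\circ},T^{\star})$ is thin if whenever $i\circ j=i'\circ j'$ with $i\ne i'$, $j\ne j'$, then $i\star j'$ is either undefined or $i\star j'=i\circ j$. A latin trade $T^{\circ}$ is minimal if whenever $(U^{\circ},U^{\star})$ is a latin bitrade (with respect to some sets of rows, columns and symbols) with $U^{\circ}\subseteq T^{\circ}$, then $U^{\circ}=T^{\circ}$.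 *)

theory Defs
  imports "HOL-Algebra.Left_Coset" "HOL-Algebra.Generated_Groups" "HOL-Number_Theory.Cong"
begin

text \<open>
  Rows, columns and symbols are elements of one type, since the three sets are compared with each
  other (they are required to be disjoint).  Coordinates are numbered 1, 2, 3.
\<close>

definition coord :: "nat \<Rightarrow> 'x \<times> 'x \<times> 'x \<Rightarrow> 'x" where
  "coord r t = (case t of (x, y, z) \<Rightarrow> if r = 1 then x else if r = 2 then y else z)"

definition partial_latin_square ::
  "'x set \<Rightarrow> 'x set \<Rightarrow> 'x set \<Rightarrow> ('x \<times> 'x \<times> 'x) set \<Rightarrow> bool" where
  "partial_latin_square A1 A2 A3 T \<longleftrightarrow>
     finite A1 \<and> finite A2 \<and> finite A3 \<and>
     A1 \<noteq> {} \<and> A2 \<noteq> {} \<and> A3 \<noteq> {} \<and>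
     A1 \<inter> A2 = {} \<and> A1 \<inter> A3 = {} \<and> A2 \<inter> A3 = {} \<and>
     T \<subseteq> A1 \<times> A2 \<times> A3 \<and>
     (\<forall>t\<in>T. \<forall>u\<in>T. card {r \<in> {1, 2, 3}. coord r t = coord r u} \<le> 1 \<or>
                   (\<forall>r\<in>{1, 2, 3}. coord r t = coord r u)) \<and>
     (\<forall>\<alpha> \<in> A1 \<union> A2 \<union> A3. \<exists>t\<in>T. \<exists>r\<in>{1, 2, 3}. coord r t = \<alpha>)"

definition latin_bitrade ::
  "'x set \<Rightarrow> 'x set \<Rightarrow> 'x set \<Rightarrow> ('x \<times> 'x \<times> 'x) set \<Rightarrow> ('x \<times> 'x \<times> 'x) set \<Rightarrow> bool" where
  "latin_bitrade A1 A2 A3 T T' \<longleftrightarrow>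
     partial_latin_square A1 A2 A3 T \<and> partial_latin_square A1 A2 A3 T' \<and>
     T \<inter> T' = {} \<and>
     (\<forall>t\<in>T. \<forall>r\<in>{1, 2, 3}. \<forall>s\<in>{1, 2, 3}. r \<noteq> s \<longrightarrow>
        (\<exists>!u. u \<in> T' \<and> coord r t = coord r u \<and> coord s t = coord s u)) \<and>
     (\<forall>t\<in>T'. \<forall>r\<in>{1, 2, 3}. \<forall>s\<in>{1, 2, 3}. r \<noteq> s \<longrightarrow>
        (\<exists>!u. u \<in> T \<and> coord r t = coord r u \<and> coord s t = coord s u))"

definition latin_trade :: "('x \<times> 'x \<times> 'x) set \<Rightarrow> bool" where
  "latin_trade T \<longleftrightarrow> (\<exists>A1 A2 A3 T'. latin_bitrade A1 A2 A3 T T')"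

definition thin_bitrade :: "('x \<times> 'x \<times> 'x) set \<Rightarrow> ('x \<times> 'x \<times> 'x) set \<Rightarrow> bool" where
  "thin_bitrade T T' \<longleftrightarrow>
     (\<forall>i j i' j' k. (i, j, k) \<in> T \<and> (i', j', k) \<in> T \<and> i \<noteq> i' \<and> j \<noteq> j' \<longrightarrow>
        (\<nexists>l. (i, j', l) \<in> T') \<or> (i, j', k) \<in> T')"

text \<open>
  Quantifying over \<open>U\<close>'s row, column and symbol sets inside the same type loses nothing: if
  \<open>U \<subseteq> T\<close>, these sets consist of coordinates of elements of \<open>T\<close>.
\<close>

definition minimal_latin_trade :: "('x \<times> 'x \<times> 'x) set \<Rightarrow> bool" where
  "minimal_latin_trade T \<longleftrightarrow> latin_trade T \<and>
     (\<forall>B1 B2 B3 U U'. latin_bitrade B1 B2 B3 U U' \<and> U \<subseteq> T \<longrightarrow> U = T)"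

end

theory Submission
  imports Defs "HOL-Algebra.Multiplicative_Group"
begin

text \<open>
  Since $a^{-1}C = bC$, the triple of $T^\star$ indexed by $g$ meets exactly the triples of
  $T^\circ$ indexed by $g$, $ga^{-1}$ and $gb$ in two coordinates.  A configuration as in the
  definition of thinness is a closed path $g \to gx \to gxy \to gxyz = g$ with $x \in A$,
  $y \in B$, $z \in C$, so thinness says that such a relation $xyz = 1$ is trivial or is $abc = 1$.

  For minimality, let $(U^\circ, U^\star)$ be a bitrade with $U^\circ \subseteq T^\circ$.
  Thinness forces $U^\star \subseteq T^\star$.  Hence the index set of $U^\circ$ is closed under
  right multiplication by $a^{\pm 1}$ and $b^{\pm 1}$, and these generate $G$.
\<close>

no_notation subset_mset (infix \<open><#\<close> 50)  \<comment> \<open>clashes with left cosets\<close>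

section \<open>Triples, partial latin squares and bitrades in general\<close>

lemma coord_simps [simp]:
  "coord 1 (x, y, z) = x" "coord (Suc 0) (x, y, z) = x" "coord 2 (x, y, z) = y" "coord 3 (x, y, z) = z"
  by (simp_all add: coord_def)

lemma coord_eqI: "(\<And>r. r \<in> {1, 2, 3} \<Longrightarrow> coord r t = coord r u) \<Longrightarrow> t = u"
  by (cases t; cases u) (metis coord_simps(1,3,4) insertI1 insertI2)

text \<open>A set has at most one element iff any two of its members agree, and agreement in all
  three coordinates is equality of triples. This replaces the cardinality form of (P1) by a rule
  that applies to two chosen coordinates.\<close>

lemma partial_latin_square_unique_iff:
  "(\<forall>t\<in>T. \<forall>u\<in>T. card {r \<in> {1, 2, 3}. coord r t = coord r u} \<le> 1 \<or>
                  (\<forall>r\<in>{1, 2, 3}. coord r t = coord r u)) \<longleftrightarrow>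
   (\<forall>t\<in>T. \<forall>u\<in>T. \<forall>r\<in>{1, 2, 3}. \<forall>s\<in>{1, 2, 3}.
      r \<noteq> s \<longrightarrow> coord r t = coord r u \<longrightarrow> coord s t = coord s u \<longrightarrow> t = u)"
proof (intro ball_cong refl)
  fix t u :: "'a \<times> 'a \<times> 'a"
  let ?R = "{r \<in> {1, 2, 3}. coord r t = coord r u}"
  have "card ?R \<le> 1 \<longleftrightarrow> (\<forall>r\<in>?R. \<forall>s\<in>?R. r = s)"
    using card_le_Suc0_iff_eq[of ?R] by simp
  moreover have "(\<forall>r\<in>{1, 2, 3}. coord r t = coord r u) \<longleftrightarrow> t = u"
    using coord_eqI[of t u] by (intro iffI) (blast, simp)
  moreover have "(\<forall>r\<in>{r \<in> I. P r}. \<forall>s\<in>{r \<in> I. P r}. r = s) \<or> Q \<longleftrightarrow>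
    (\<forall>r\<in>I. \<forall>s\<in>I. r \<noteq> s \<longrightarrow> P r \<longrightarrow> P s \<longrightarrow> Q)" for I :: "nat set" and P Q
    by blast
  ultimately show "(card ?R \<le> 1 \<or> (\<forall>r\<in>{1, 2, 3}. coord r t = coord r u)) \<longleftrightarrow>
    (\<forall>r\<in>{1, 2, 3}. \<forall>s\<in>{1, 2, 3}.
      r \<noteq> s \<longrightarrow> coord r t = coord r u \<longrightarrow> coord s t = coord s u \<longrightarrow> t = u)"
    by (simp only:)
qed

lemma partial_latin_square_unique:
  assumes "partial_latin_square A1 A2 A3 T" "t \<in> T" "u \<in> T" "r \<in> {1, 2, 3}" "s \<in> {1, 2, 3}" "r \<noteq> s"
    and "coord r t = coord r u" "coord s t = coord s u"
  shows "t = u"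
proof -
  have "\<forall>t\<in>T. \<forall>u\<in>T. \<forall>r\<in>{1, 2, 3}. \<forall>s\<in>{1, 2, 3}.
      r \<noteq> s \<longrightarrow> coord r t = coord r u \<longrightarrow> coord s t = coord s u \<longrightarrow> t = u"
    using assms(1) unfolding partial_latin_square_def partial_latin_square_unique_iff by (elim conjE)
  from this[rule_format, OF assms(2-)] show ?thesis .
qed

text \<open>Uniqueness in (R2) and (R3) is already contained in (P1): two candidates would agree in
  the coordinates \<open>r\<close> and \<open>s\<close>. Only existence has to be supplied.\<close>

lemma latin_bitradeI:
  assumes T: "partial_latin_square A1 A2 A3 T" and T': "partial_latin_square A1 A2 A3 T'"
    and "T \<inter> T' = {}"
    and ex: "\<And>t r s. \<lbrakk>t \<in> T; r \<in> {1, 2, 3}; s \<in> {1, 2, 3}; r \<noteq> s\<rbrakk> \<Longrightarrow>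
              \<exists>u\<in>T'. coord r t = coord r u \<and> coord s t = coord s u"
    and ex': "\<And>t r s. \<lbrakk>t \<in> T'; r \<in> {1, 2, 3}; s \<in> {1, 2, 3}; r \<noteq> s\<rbrakk> \<Longrightarrow>
              \<exists>u\<in>T. coord r t = coord r u \<and> coord s t = coord s u"
  shows "latin_bitrade A1 A2 A3 T T'"
proof -
  have ex1: "\<exists>!u. u \<in> S \<and> coord r t = coord r u \<and> coord s t = coord s u"
    if S: "partial_latin_square A1 A2 A3 S" and ex: "\<exists>u\<in>S. coord r t = coord r u \<and> coord s t = coord s u"
      and rs: "r \<in> {1, 2, 3}" "s \<in> {1, 2, 3}" "r \<noteq> s" for S t r s
  proof -
    obtain u where u: "u \<in> S" "coord r t = coord r u" "coord s t = coord s u"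
      using ex by blast
    show ?thesis
    proof (rule ex1I[of _ u])
      fix v
      assume v: "v \<in> S \<and> coord r t = coord r v \<and> coord s t = coord s v"
      then have "coord r v = coord r u" "coord s v = coord s u"
        using u by simp_all
      with v show "v = u"
        by (intro partial_latin_square_unique[OF S _ u(1) rs]) blast+
    qed (use u in simp)
  qed
  show ?thesis
    unfolding latin_bitrade_def
    by (intro conjI ballI impI T T' assms(3) ex1[OF T' ex] ex1[OF T ex'])
qed

text \<open>There is at least one row, and (P2) places it in a triple. This yields the starting
  point of the minimality argument.\<close>

lemma latin_bitrade_nonempty:
  assumes "latin_bitrade A1 A2 A3 T T'"
  shows "T \<noteq> {}"
proof -
  have "partial_latin_square A1 A2 A3 T"
    using assms unfolding latin_bitrade_def by (elim conjE)
  then have "A1 \<noteq> {}" and "\<forall>\<alpha> \<in> A1 \<union> A2 \<union> A3. \<exists>t\<in>T. \<exists>r\<in>{1, 2, 3}. coord r t = \<alpha>"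
    unfolding partial_latin_square_def by - (elim conjE, assumption)+
  then show ?thesis
    by auto
qed

lemma latin_bitrade_sym: "latin_bitrade A1 A2 A3 T T' \<Longrightarrow> latin_bitrade A1 A2 A3 T' T"
  unfolding latin_bitrade_def
  by (elim conjE, intro conjI) (assumption | subst Int_commute, assumption)+

lemma latin_bitrade_mate:
  assumes "latin_bitrade A1 A2 A3 T T'" and "t \<in> T" and "r \<in> {1, 2, 3}" and "s \<in> {1, 2, 3}"
    and "r \<noteq> s"
  obtains u where "u \<in> T'" and "coord r t = coord r u" and "coord s t = coord s u"
proof -
  have "\<forall>t\<in>T. \<forall>r\<in>{1, 2, 3}. \<forall>s\<in>{1, 2, 3}. r \<noteq> s \<longrightarrow>
        (\<exists>!u. u \<in> T' \<and> coord r t = coord r u \<and> coord s t = coord s u)"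
    using assms(1) unfolding latin_bitrade_def by (elim conjE)
  from this[rule_format, OF assms(2-5)] that show thesis
    by blast
qed

lemma thin_bitradeD:
  assumes "thin_bitrade T T'" "(i, j, k) \<in> T" "(i', j', k) \<in> T" "i \<noteq> i'" "j \<noteq> j'" "(i, j', l) \<in> T'"
  shows "(i, j', k) \<in> T'"
  using assms unfolding thin_bitrade_def by blast

text \<open>A triple \<open>t\<close> of \<open>U'\<close> has mates in \<open>U\<close>, hence in
  \<open>T\<close>. Those sharing its symbol form exactly the configuration in the definition of
  thinness; they differ in row and column because \<open>t\<close> itself is not in
  \<open>U\<close>.\<close>

lemma thin_bitrade_subset:
  assumes T: "latin_bitrade A1 A2 A3 T T'" and thin: "thin_bitrade T T'"
    and U: "latin_bitrade B1 B2 B3 U U'" and "U \<subseteq> T"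
  shows "U' \<subseteq> T'"
proof
  fix t assume t: "t \<in> U'"
  obtain i j' k where tijk: "t = (i, j', k)"
    by (cases t)
  have "t \<notin> U"
    using U t by (auto simp: latin_bitrade_def)
  note mate = latin_bitrade_mate[OF latin_bitrade_sym[OF U] t]
  obtain j where j: "(i, j, k) \<in> U"
    by (rule mate[of 1 3]) (auto simp: tijk)
  obtain i' where i': "(i', j', k) \<in> U"
    by (rule mate[of 2 3]) (auto simp: tijk)
  \<comment> \<open>This mate only shows that the cell \<open>(i, j')\<close> is filled in
    \<open>T\<close>, hence in \<open>T'\<close>; thinness says nothing about cells that are empty
    in \<open>T'\<close>.\<close>
  obtain l where "(i, j', l) \<in> U"
    by (rule mate[of 1 2]) (auto simp: tijk)
  then obtain l' where "(i, j', l') \<in> T'"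
    using \<open>U \<subseteq> T\<close> by (auto intro: latin_bitrade_mate[OF T, of _ 1 2])
  moreover have "i \<noteq> i'" "j \<noteq> j'"
    using i' j \<open>t \<notin> U\<close> tijk by auto
  ultimately show "t \<in> T'"
    unfolding tijk
    using thin_bitradeD[OF thin subsetD[OF \<open>U \<subseteq> T\<close> j] subsetD[OF \<open>U \<subseteq> T\<close> i']] by blast
qed

section \<open>Left cosets and powers in a group\<close>

context group
begin

lemma mult_inv_cancel: "\<lbrakk>x \<in> carrier G; y \<in> carrier G\<rbrakk> \<Longrightarrow> x \<otimes> (inv x \<otimes> y) = y"
  by (simp flip: m_assoc)

lemma l_coset_eq_iff:
  assumes "subgroup H G" "g \<in> carrier G" "h \<in> carrier G"
  shows "g <# H = h <# H \<longleftrightarrow> inv g \<otimes> h \<in> H"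
  using assms
  by (metis is_group l_repr_independence lcos_self subgroup.lcos_module_imp subgroup.lcos_module_rev)

lemma l_coset_mult_right:
  assumes "subgroup H G" "g \<in> carrier G" "h \<in> H"
  shows "(g \<otimes> h) <# H = g <# H"
  using assms by (metis l_coset_def UN_I insertI1 l_repr_independence)

text \<open>The quotient \<open>inv g \<otimes> h\<close> lies in both subgroups, so it is trivial.
  This is the source of (P1): two coordinates determine the group element.\<close>

lemma l_cosets_eq_imp_eq:
  assumes "subgroup H G" "subgroup K G" "H \<inter> K = {\<one>}" "g \<in> carrier G" "h \<in> carrier G"
    and "g <# H = h <# H" "g <# K = h <# K"
  shows "g = h"
proof -
  have "inv g \<otimes> h \<in> H \<inter> K"
    using assms l_coset_eq_iff by blast
  then have "inv g \<otimes> h = \<one>"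
    using assms(3) by blast
  then show ?thesis
    using assms(4,5) by (metis inv_equality inv_inv inv_closed)
qed

text \<open>A left coset determines its subgroup: translating it back by one of its elements
  recovers the subgroup.\<close>

lemma lcosets_disjoint:
  assumes "subgroup H G" "subgroup K G" "H \<noteq> K"
  shows "lcosets H \<inter> lcosets K = {}"
proof (rule ccontr)
  assume "lcosets H \<inter> lcosets K \<noteq> {}"
  then obtain g h where gh: "g \<in> carrier G" "h \<in> carrier G" "g <# H = h <# K"
    unfolding LCOSETS_def by blast
  then have "g \<in> h <# K"
    using assms(1) lcos_self by blast
  then have "g <# H = g <# K"
    using gh assms l_repr_independence by metis
  moreover have "\<one> <# L = inv g <# (g <# L)" if "subgroup L G" for L
    using that gh by (simp add: lcos_m_assoc subgroup.subset)
  ultimately have "\<one> <# H = \<one> <# K"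
    using assms by simp
  then show False
    using assms by (simp add: lcos_mult_one subgroup.subset)
qed

text \<open>The order of \<open>x\<close> is the size of the cyclic subgroup it generates, the
  modulus used in the theorem.\<close>

lemma int_pow_eq_iff_cong:
  assumes "finite (carrier G)" "x \<in> carrier G"
  shows "x [^] (i :: int) = x [^] j \<longleftrightarrow> [i = j] (mod int (card (generate G {x})))"
  using assms by (metis int_pow_eq generate_pow_card cong_iff_dvd_diff cong_sym_eq)

end

section \<open>The bitrade built from the group\<close>

locale bitrade_group = group G for G (structure) +
  fixes a b c :: 'a and A B C :: "'a set"
  assumes finite_carrier: "finite (carrier G)"
    and a_closed [simp]: "a \<in> carrier G" and b_closed [simp]: "b \<in> carrier G"
    and c_closed [simp]: "c \<in> carrier G"
    and a_neq_one: "a \<noteq> \<one>" and b_neq_one: "b \<noteq> \<one>"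
    and A_def: "A = generate G {a}" and B_def: "B = generate G {b}" and C_def: "C = generate G {c}"
    and abc: "a \<otimes> b \<otimes> c = \<one>"
    and AB: "A \<inter> B = {\<one>}" and AC: "A \<inter> C = {\<one>}" and BC: "B \<inter> C = {\<one>}"
    and generating: "carrier G = generate G {a, b, c}"
begin

text \<open>Triples are indexed by group elements, so that passing from one triple to another
  becomes right multiplication. The index can be recovered by \<open>circ_eqI\<close> and
  \<open>star_eqI\<close>.\<close>

definition circ :: "'a \<Rightarrow> 'a set \<times> 'a set \<times> 'a set" where
  "circ g = (g <# A, g <# B, g <# C)"

definition star :: "'a \<Rightarrow> 'a set \<times> 'a set \<times> 'a set" where
  "star g = (g <# A, g <# B, (g \<otimes> inv a) <# C)"

lemma subgroups: "subgroup A G" "subgroup B G" "subgroup C G"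
  by (simp_all add: A_def B_def C_def generate_is_subgroup)

lemma generators_mem: "a \<in> A" "b \<in> B" "c \<in> C" "inv a \<in> A" "inv b \<in> B" "inv c \<in> C"
  by (auto simp: A_def B_def C_def intro: generate.incl generate.inv)

lemma inv_c: "inv c = a \<otimes> b"
  using abc by (simp add: inv_equality)

lemma inv_a: "inv a = b \<otimes> c"
  using abc by (metis a_closed b_closed c_closed inv_unique m_assoc m_closed r_inv inv_comm inv_equality)

lemma coset_shift_A [simp]:
  "g \<in> carrier G \<Longrightarrow> (g \<otimes> a) <# A = g <# A" "g \<in> carrier G \<Longrightarrow> (g \<otimes> inv a) <# A = g <# A"
  by (simp_all add: l_coset_mult_right subgroups generators_mem)

lemma coset_shift_B [simp]:
  "g \<in> carrier G \<Longrightarrow> (g \<otimes> b) <# B = g <# B" "g \<in> carrier G \<Longrightarrow> (g \<otimes> inv b) <# B = g <# B"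
  by (simp_all add: l_coset_mult_right subgroups generators_mem)

text \<open>As \<open>inv a\<close> is \<open>b \<otimes> c\<close>, the representatives differ by
  the right factor \<open>c\<close>. The second form is the one suited to comparing columns and
  symbols.\<close>

lemma coset_shift_C: "g \<in> carrier G \<Longrightarrow> (g \<otimes> inv a) <# C = (g \<otimes> b) <# C"
  using l_coset_mult_right[OF subgroups(3) _ generators_mem(3), of "g \<otimes> b"]
  by (simp add: inv_a m_assoc)

lemma circ_eqI:
  assumes "g \<in> carrier G" "h \<in> carrier G" "r \<in> {1, 2, 3}" "s \<in> {1, 2, 3}" "r \<noteq> s"
    and "coord r (circ g) = coord r (circ h)" "coord s (circ g) = coord s (circ h)"
  shows "g = h"
  using assms(3-) l_cosets_eq_imp_eq[OF subgroups(1,2) AB assms(1,2)]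
    l_cosets_eq_imp_eq[OF subgroups(1,3) AC assms(1,2)]
    l_cosets_eq_imp_eq[OF subgroups(2,3) BC assms(1,2)]
  by (auto simp: circ_def)

text \<open>Each pair of coordinates of \<open>star g\<close> consists of two cosets of one element:
  \<open>g\<close> for row and column, \<open>g \<otimes> inv a\<close> for row and symbol,
  \<open>g \<otimes> b\<close> for column and symbol.\<close>

lemma star_eqI:
  assumes gh: "g \<in> carrier G" "h \<in> carrier G" and rs: "r \<in> {1, 2, 3}" "s \<in> {1, 2, 3}" "r \<noteq> s"
    and eq: "coord r (star g) = coord r (star h)" "coord s (star g) = coord s (star h)"
  shows "g = h"
proof -
  consider "g <# A = h <# A" "g <# B = h <# B"
    | "g <# A = h <# A" "(g \<otimes> inv a) <# C = (h \<otimes> inv a) <# C"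
    | "g <# B = h <# B" "(g \<otimes> inv a) <# C = (h \<otimes> inv a) <# C"
    using rs eq by (auto simp: star_def)
  then show ?thesis
  proof cases
    case 1
    then show ?thesis
      using l_cosets_eq_imp_eq[OF subgroups(1,2) AB gh] by blast
  next
    case 2
    then have "g \<otimes> inv a = h \<otimes> inv a"
      using l_cosets_eq_imp_eq[OF subgroups(1,3) AC, of "g \<otimes> inv a" "h \<otimes> inv a"] gh by simp
    then show ?thesis
      using gh by simp
  next
    case 3
    then have "g \<otimes> b = h \<otimes> b"
      using l_cosets_eq_imp_eq[OF subgroups(2,3) BC, of "g \<otimes> b" "h \<otimes> b"] gh
      by (simp add: coset_shift_C)
    then show ?thesis
      using gh by simp
  qed
qed

text \<open>Here and in the next two lemmas the representatives are chosen to expose a shared pair: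
  row and symbol with \<open>circ g\<close>, then column and symbol with \<open>circ g\<close>, then
  column and symbol with \<open>circ (g \<otimes> b)\<close>.\<close>

lemma star_a: "g \<in> carrier G \<Longrightarrow> star (g \<otimes> a) = (g <# A, (g \<otimes> a) <# B, g <# C)"
  by (simp add: star_def m_assoc)

lemma star_inv_b: "g \<in> carrier G \<Longrightarrow> star (g \<otimes> inv b) = ((g \<otimes> inv b) <# A, g <# B, g <# C)"
  using coset_shift_C[of "g \<otimes> inv b"] by (simp add: star_def m_assoc)

lemma star_conv_b: "g \<in> carrier G \<Longrightarrow> star g = (g <# A, (g \<otimes> b) <# B, (g \<otimes> b) <# C)"
  by (simp add: star_def coset_shift_C)

lemma two_coords_cases:
  fixes r s :: nat
  assumes "r \<in> {1, 2, 3}" "s \<in> {1, 2, 3}" "r \<noteq> s"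
  obtains "r \<in> {1, 2}" "s \<in> {1, 2}" | "r \<in> {1, 3}" "s \<in> {1, 3}" | "r \<in> {2, 3}" "s \<in> {2, 3}"
  using assms by auto

lemma ex_star_mate:
  assumes g: "g \<in> carrier G" and rs: "r \<in> {1, 2, 3}" "s \<in> {1, 2, 3}" "r \<noteq> s"
  shows "\<exists>h\<in>carrier G. coord r (circ g) = coord r (star h) \<and> coord s (circ g) = coord s (star h)"
  using rs
proof (cases rule: two_coords_cases)
  case 1
  then show ?thesis
    using g by (intro bexI[of _ g]) (auto simp: circ_def star_def)
next
  case 2
  then show ?thesis
    using g by (intro bexI[of _ "g \<otimes> a"]) (auto simp: circ_def star_a)
next
  case 3
  then show ?thesis
    using g by (intro bexI[of _ "g \<otimes> inv b"]) (auto simp: circ_def star_inv_b)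
qed

lemma ex_circ_mate:
  assumes g: "g \<in> carrier G" and rs: "r \<in> {1, 2, 3}" "s \<in> {1, 2, 3}" "r \<noteq> s"
  shows "\<exists>h\<in>carrier G. coord r (star g) = coord r (circ h) \<and> coord s (star g) = coord s (circ h)"
  using rs
proof (cases rule: two_coords_cases)
  case 1
  then show ?thesis
    using g by (intro bexI[of _ g]) (auto simp: circ_def star_def)
next
  case 2
  then show ?thesis
    using g by (intro bexI[of _ "g \<otimes> inv a"]) (auto simp: circ_def star_def)
next
  case 3
  then show ?thesis
    using g by (intro bexI[of _ "g \<otimes> b"]) (auto simp: circ_def star_conv_b)
qed

lemma
  shows partial_latin_square_circ:
    "partial_latin_square (lcosets A) (lcosets B) (lcosets C) (circ ` carrier G)"
  and partial_latin_square_star: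
    "partial_latin_square (lcosets A) (lcosets B) (lcosets C) (star ` carrier G)"
proof -
  have fin: "finite (lcosets H)" "lcosets H \<noteq> {}" for H
    using finite_carrier by (auto simp: LCOSETS_def)
  \<comment> \<open>If two of the subgroups coincided, their trivial intersection would contain
    \<open>a\<close> or \<open>b\<close>.\<close>
  have neq: "A \<noteq> B" "A \<noteq> C" "B \<noteq> C"
    using AB AC BC a_neq_one b_neq_one generators_mem by blast+
  note disj = lcosets_disjoint[OF subgroups(1,2) neq(1)] lcosets_disjoint[OF subgroups(1,3) neq(2)]
    lcosets_disjoint[OF subgroups(2,3) neq(3)]
  have mem: "g <# H \<in> lcosets H" if "g \<in> carrier G" for g H
    using that unfolding LCOSETS_def by blast
  have sub: "circ ` carrier G \<subseteq> (lcosets A) \<times> (lcosets B) \<times> (lcosets C)"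
      "star ` carrier G \<subseteq> (lcosets A) \<times> (lcosets B) \<times> (lcosets C)"
    using mem by (auto simp: circ_def star_def)
  \<comment> \<open>Stated for a general parametrization \<open>f\<close>, to serve
    \<open>circ\<close> and \<open>star\<close> alike; the symbol may sit at another index
    \<open>h\<close>, as it does for \<open>star\<close>.\<close>
  have P2: "\<forall>\<alpha>\<in>lcosets A \<union> lcosets B \<union> lcosets C. \<exists>t\<in>f ` carrier G. \<exists>r\<in>{1, 2, 3}. coord r t = \<alpha>"
    if A: "\<And>g. g \<in> carrier G \<Longrightarrow> coord 1 (f g) = g <# A"
      and B: "\<And>g. g \<in> carrier G \<Longrightarrow> coord 2 (f g) = g <# B"
      and C: "\<And>g. g \<in> carrier G \<Longrightarrow> \<exists>h\<in>carrier G. coord 3 (f h) = g <# C" for f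
  proof
    fix \<alpha>
    assume "\<alpha> \<in> lcosets A \<union> lcosets B \<union> lcosets C"
    then obtain g where g: "g \<in> carrier G" and "\<alpha> = g <# A \<or> \<alpha> = g <# B \<or> \<alpha> = g <# C"
      unfolding LCOSETS_def by blast
    then show "\<exists>t\<in>f ` carrier G. \<exists>r\<in>{1, 2, 3}. coord r t = \<alpha>"
      using A[OF g] B[OF g] C[OF g] by auto
  qed
  have unique: "\<forall>t\<in>f ` carrier G. \<forall>u\<in>f ` carrier G. \<forall>r\<in>{1, 2, 3}. \<forall>s\<in>{1, 2, 3}.
      r \<noteq> s \<longrightarrow> coord r t = coord r u \<longrightarrow> coord s t = coord s u \<longrightarrow> t = u"
    if eqI: "\<And>g h r s. \<lbrakk>g \<in> carrier G; h \<in> carrier G; r \<in> {1, 2, 3}; s \<in> {1, 2, 3}; r \<noteq> s;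
      coord r (f g) = coord r (f h); coord s (f g) = coord s (f h)\<rbrakk> \<Longrightarrow> g = h"
    for f :: "'a \<Rightarrow> 'a set \<times> 'a set \<times> 'a set"
  proof (intro ballI impI)
    fix t u r s
    assume "t \<in> f ` carrier G" "u \<in> f ` carrier G" and rs: "r \<in> {1, 2, 3}" "s \<in> {1, 2, 3}" "r \<noteq> (s :: nat)"
      and eq: "coord r t = coord r u" "coord s t = coord s u"
    then obtain g h where gh: "g \<in> carrier G" "t = f g" "h \<in> carrier G" "u = f h"
      by blast
    then show "t = u"
      using eqI[OF gh(1,3) rs] eq by simp
  qed
  have C: "\<exists>h\<in>carrier G. coord 3 (star h) = g <# C" if "g \<in> carrier G" for g
    using that by (intro bexI[of _ "g \<otimes> a"]) (simp_all add: star_a)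
  show "partial_latin_square (lcosets A) (lcosets B) (lcosets C) (circ ` carrier G)"
    unfolding partial_latin_square_def partial_latin_square_unique_iff
    by (intro conjI fin disj sub(1) P2 unique) (erule (6) circ_eqI | auto simp: circ_def)+
  show "partial_latin_square (lcosets A) (lcosets B) (lcosets C) (star ` carrier G)"
    unfolding partial_latin_square_def partial_latin_square_unique_iff
    by (intro conjI fin disj sub(2) P2 C unique) (erule (6) star_eqI | simp add: star_def)+
qed

lemma latin_bitrade_circ_star:
  "latin_bitrade (lcosets A) (lcosets B) (lcosets C) (circ ` carrier G) (star ` carrier G)"
proof (rule latin_bitradeI[OF partial_latin_square_circ partial_latin_square_star])
  show "circ ` carrier G \<inter> star ` carrier G = {}"
  proof (rule ccontr)
    assume "circ ` carrier G \<inter> star ` carrier G \<noteq> {}"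
    then obtain g h where gh: "g \<in> carrier G" "h \<in> carrier G" "circ g = star h"
      by blast
    \<comment> \<open>Row and column force equal indices; row and symbol force a shift by
      \<open>inv a\<close>. Together they would make \<open>a\<close> trivial.\<close>
    then have "g = h"
      by (intro l_cosets_eq_imp_eq[OF subgroups(1,2) AB]) (auto simp: circ_def star_def)
    then have "g = h \<otimes> inv a"
      using gh by (intro l_cosets_eq_imp_eq[OF subgroups(1,3) AC]) (auto simp: circ_def star_def)
    then show False
      using gh \<open>g = h\<close> a_neq_one by (simp add: inv_solve_right)
  qed
next
  fix t r s
  assume "t \<in> circ ` carrier G" and rs: "r \<in> {1, 2, 3}" "s \<in> {1, 2, 3}" "r \<noteq> (s :: nat)"
  then obtain g where g: "g \<in> carrier G" "t = circ g"
    by blast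
  then show "\<exists>u\<in>star ` carrier G. coord r t = coord r u \<and> coord s t = coord s u"
    using ex_star_mate[OF g(1) rs] by auto
next
  fix t r s
  assume "t \<in> star ` carrier G" and rs: "r \<in> {1, 2, 3}" "s \<in> {1, 2, 3}" "r \<noteq> (s :: nat)"
  then obtain g where g: "g \<in> carrier G" "t = star g"
    by blast
  then show "\<exists>u\<in>circ ` carrier G. coord r t = coord r u \<and> coord s t = coord s u"
    using ex_circ_mate[OF g(1) rs] by auto
qed

section \<open>Thinness and the relations among elements of the three subgroups\<close>

lemma thin_bitrade_iff_relations:
  "thin_bitrade (circ ` carrier G) (star ` carrier G) \<longleftrightarrow>
   (\<forall>x\<in>A. \<forall>y\<in>B. \<forall>z\<in>C. x \<otimes> y \<otimes> z = \<one> \<longrightarrow>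
      x = \<one> \<and> y = \<one> \<and> z = \<one> \<or> x = a \<and> y = b \<and> z = c)" (is "?thin \<longleftrightarrow> ?rel")
proof
  assume thin: ?thin
  show ?rel
  proof (intro ballI impI)
    fix x y z
    assume xyz: "x \<in> A" "y \<in> B" "z \<in> C" "x \<otimes> y \<otimes> z = \<one>"
    then have car [simp]: "x \<in> carrier G" "y \<in> carrier G" "z \<in> carrier G"
      using subgroups[THEN subgroup.mem_carrier] by auto
    have inv_z: "inv z = x \<otimes> y"
      using xyz(4) by (simp add: inv_equality)
    show "x = \<one> \<and> y = \<one> \<and> z = \<one> \<or> x = a \<and> y = b \<and> z = c"
    \<comment> \<open>For trivial \<open>z\<close> the element \<open>x = inv y\<close> lies in
      \<open>A \<inter> B\<close>. Otherwise \<open>x \<otimes> y = inv z\<close> lies in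
      \<open>C\<close> but in neither \<open>A\<close> nor \<open>B\<close>, so
      \<open>circ \<one>\<close> and \<open>circ (x \<otimes> y)\<close> share only their symbol, as
      thinness requires.\<close>
    proof (cases "z = \<one>")
      case True
      then have "x = inv y"
        using xyz(4) by (simp add: inv_equality)
      then have "x \<in> A \<inter> B"
        using xyz subgroups by (simp add: subgroup.m_inv_closed)
      then have "x = \<one>"
        using AB by blast
      then show ?thesis
        using True xyz(4) by simp
    next
      case False
      have "z = inv (x \<otimes> y)"
        by (simp flip: inv_z)
      have notin: "x \<otimes> y \<notin> H" if H: "subgroup H G" "H \<inter> C = {\<one>}" for H
      proof
        assume "x \<otimes> y \<in> H"
        then have "z \<in> H \<inter> C"
          using subgroup.m_inv_closed[OF H(1)] xyz(3) \<open>z = inv (x \<otimes> y)\<close> by blast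
        then show False
          using False H(2) by blast
      qed
      have neq: "\<one> <# A \<noteq> (x \<otimes> y) <# A" "\<one> <# B \<noteq> (x \<otimes> y) <# B"
        using notin[OF subgroups(1) AC] l_coset_eq_iff[OF subgroups(1), of \<one> "x \<otimes> y"]
          notin[OF subgroups(2) BC] l_coset_eq_iff[OF subgroups(2), of \<one> "x \<otimes> y"] by auto
      have "(x \<otimes> y) <# C = \<one> <# C"
        using l_coset_mult_right[OF subgroups(3) one_closed subgroup.m_inv_closed[OF subgroups(3) xyz(3)]]
        by (simp add: inv_z)
      then have circs: "(\<one> <# A, \<one> <# B, \<one> <# C) \<in> circ ` carrier G"
          "((x \<otimes> y) <# A, (x \<otimes> y) <# B, \<one> <# C) \<in> circ ` carrier G"
        using imageI[of \<one> "carrier G" circ] imageI[of "x \<otimes> y" "carrier G" circ]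
        by (simp_all add: circ_def)
      have xA: "x <# A = \<one> <# A"
        using l_coset_mult_right[OF subgroups(1) one_closed xyz(1)] by simp
      have xyB: "(x \<otimes> y) <# B = x <# B"
        using l_coset_mult_right[OF subgroups(2) car(1) xyz(2)] by simp
      \<comment> \<open>The triple \<open>star x\<close> fills the cell in the row of
        \<open>\<one>\<close> and the column of \<open>x \<otimes> y\<close>; thinness then
        prescribes its symbol.\<close>
      have "(\<one> <# A, (x \<otimes> y) <# B, (x \<otimes> inv a) <# C) \<in> star ` carrier G"
        using imageI[of x "carrier G" star] by (simp add: star_def xA xyB)
      then have "(\<one> <# A, (x \<otimes> y) <# B, \<one> <# C) \<in> star ` carrier G"
        by (rule thin_bitradeD[OF thin circs neq])
      then obtain g where g: "g \<in> carrier G" "star g = (x <# A, x <# B, \<one> <# C)"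
        using xA xyB by auto
      then have "g = x"
        using star_eqI[of g x 1 2] by (simp add: star_def)
      \<comment> \<open>Comparing actual and prescribed symbol puts \<open>x \<otimes> inv a\<close>
        in \<open>A \<inter> C\<close>, whence \<open>x = a\<close>.\<close>
      then have "(x \<otimes> inv a) <# C = \<one> <# C"
        using g by (simp add: star_def)
      then have "x \<otimes> inv a \<in> C"
        using l_coset_eq_iff[OF subgroups(3), of \<one> "x \<otimes> inv a"] by simp
      moreover have "x \<otimes> inv a \<in> A"
        using xyz generators_mem subgroups by (simp add: subgroup.m_closed)
      ultimately have "x \<otimes> inv a = \<one>"
        using AC by blast
      then have "x = a"
        by (simp add: inv_solve_right')
      then have "a \<otimes> (b \<otimes> c) = a \<otimes> (y \<otimes> z)"
        using xyz(4) abc by (simp add: m_assoc)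
      then have bc: "b \<otimes> c = y \<otimes> z"
        by simp
      \<comment> \<open>Separating the factors of \<open>b \<otimes> c = y \<otimes> z\<close>
        produces an element of \<open>B \<inter> C\<close>, so \<open>y = b\<close> and
        \<open>z = c\<close>.\<close>
      have "c \<otimes> inv z = inv b \<otimes> (b \<otimes> c) \<otimes> inv z"
        by (simp flip: m_assoc)
      also have "\<dots> = inv b \<otimes> y"
        unfolding bc by (simp add: m_assoc)
      finally have "inv b \<otimes> y = c \<otimes> inv z"
        by simp
      moreover have "inv b \<otimes> y \<in> B" "c \<otimes> inv z \<in> C"
        using xyz generators_mem subgroups by (simp_all add: subgroup.m_closed subgroup.m_inv_closed)
      ultimately have "inv b \<otimes> y = \<one>" "c \<otimes> inv z = \<one>"
        using BC by auto
      then show ?thesis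
        using \<open>x = a\<close> by (simp add: inv_solve_left' inv_solve_right')
    qed
  qed
next
  assume rel: ?rel
  show ?thin
    unfolding thin_bitrade_def
  proof (intro allI impI)
    fix i j i' j' k
    assume asm: "(i, j, k) \<in> circ ` carrier G \<and> (i', j', k) \<in> circ ` carrier G \<and> i \<noteq> i' \<and> j \<noteq> j'"
    then obtain g h where g: "g \<in> carrier G" "i = g <# A" "j = g <# B" "k = g <# C"
      and h: "h \<in> carrier G" "i' = h <# A" "j' = h <# B" "k = h <# C"
      by (auto simp: circ_def)
    show "(\<nexists>l. (i, j', l) \<in> star ` carrier G) \<or> (i, j', k) \<in> star ` carrier G"
    proof (cases "\<exists>l. (i, j', l) \<in> star ` carrier G")
      case True
      then obtain s where s: "s \<in> carrier G" "i = s <# A" "j' = s <# B"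
        by (auto simp: star_def)
      \<comment> \<open>On the closed path from \<open>g\<close> to \<open>s\<close> to
        \<open>h\<close> and back, the steps keep the row, the column and the symbol in
        turn.\<close>
      have "inv g \<otimes> s \<in> A" "inv s \<otimes> h \<in> B" "inv h \<otimes> g \<in> C"
        using l_coset_eq_iff[OF subgroups(1) g(1) s(1)] l_coset_eq_iff[OF subgroups(2) s(1) h(1)]
          l_coset_eq_iff[OF subgroups(3) h(1) g(1)] g(2,4) h(3,4) s(2,3) by simp_all
      moreover have "inv g \<otimes> s \<otimes> (inv s \<otimes> h) \<otimes> (inv h \<otimes> g) = \<one>"
        using g(1) h(1) s(1) by (simp add: m_assoc mult_inv_cancel)
      \<comment> \<open>The rows \<open>i\<close> and \<open>i'\<close> differ, so \<open>g\<close>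
        and \<open>h\<close> do; this rules out the trivial relation.\<close>
      moreover have "inv h \<otimes> g \<noteq> \<one>"
        using asm g h by (auto simp: inv_solve_left')
      ultimately have "inv g \<otimes> s = a"
        using rel by blast
      then have "s = g \<otimes> a"
        using g(1) s(1) by (simp add: inv_solve_left')
      then have "star s = (i, j', k)"
        using star_a[OF g(1)] g s by simp
      then show ?thesis
        using s(1) by force
    qed blast
  qed
qed

text \<open>Elements of the cyclic subgroups are integer powers, and the congruences are equalities
  of powers. That both listed exponent triples do solve the equation follows from
  \<open>abc\<close>.\<close>

lemma thin_bitrade_iff_int_pow:
  "thin_bitrade (circ ` carrier G) (star ` carrier G) \<longleftrightarrow>
   (\<forall>i j k :: int. a [^] i \<otimes> b [^] j \<otimes> c [^] k = \<one> \<longleftrightarrow>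
      ([i = 0] (mod int (card A)) \<and> [j = 0] (mod int (card B)) \<and> [k = 0] (mod int (card C)))
    \<or> ([i = 1] (mod int (card A)) \<and> [j = 1] (mod int (card B)) \<and> [k = 1] (mod int (card C))))"
proof -
  have cong0: "[i = 0] (mod int (card (generate G {x}))) \<longleftrightarrow> x [^] i = \<one>"
    and cong1: "[i = 1] (mod int (card (generate G {x}))) \<longleftrightarrow> x [^] i = x"
    if "x \<in> carrier G" for x and i :: int
    using int_pow_eq_iff_cong[OF finite_carrier that, of i] that
    by (metis int_pow_0, metis int_pow_1)
  have *: "(\<forall>x\<in>generate G {u}. P x) \<longleftrightarrow> (\<forall>i::int. P (u [^] i))" if "u \<in> carrier G" for u P
    using that by (auto simp: generate_pow)
  show ?thesis
    unfolding thin_bitrade_iff_relations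
    by (simp add: A_def B_def C_def cong0 cong1 *) (use abc in auto)
qed

section \<open>Minimality\<close>

lemma minimal_latin_trade_circ:
  assumes thin: "thin_bitrade (circ ` carrier G) (star ` carrier G)"
  shows "minimal_latin_trade (circ ` carrier G)"
  unfolding minimal_latin_trade_def
proof (intro conjI allI impI)
  show "latin_trade (circ ` carrier G)"
    using latin_bitrade_circ_star unfolding latin_trade_def by blast
next
  fix B1 B2 B3 U U'
  assume asm: "latin_bitrade B1 B2 B3 U U' \<and> U \<subseteq> circ ` carrier G"
  then have U: "latin_bitrade B1 B2 B3 U U'" and sub: "U \<subseteq> circ ` carrier G"
    by auto
  have sub': "U' \<subseteq> star ` carrier G"
    using thin_bitrade_subset[OF latin_bitrade_circ_star thin U sub] .
  \<comment> \<open>The mate that \<open>circ g\<close> has in \<open>U'\<close> is some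
    \<open>star k\<close>; two coordinates determine the index, so it must be
    \<open>star h\<close>.\<close>
  have star_mem: "star h \<in> U'"
    if g: "circ g \<in> U" and h: "h \<in> carrier G" and rs: "r \<in> {1, 2, 3}" "s \<in> {1, 2, 3}" "r \<noteq> s"
      and eq: "coord r (circ g) = coord r (star h)" "coord s (circ g) = coord s (star h)" for g h r s
  proof -
    obtain u where u: "u \<in> U'" "coord r (circ g) = coord r u" "coord s (circ g) = coord s u"
      by (rule latin_bitrade_mate[OF U g rs])
    obtain k where k: "k \<in> carrier G" "u = star k"
      using u(1) sub' by blast
    have "k = h"
      by (rule star_eqI[OF k(1) h rs]) (use u(2,3) k(2) eq in simp_all)
    then show ?thesis
      using u(1) k(2) by simp
  qed
  have circ_mem: "circ h \<in> U"
    if g: "star g \<in> U'" and h: "h \<in> carrier G" and rs: "r \<in> {1, 2, 3}" "s \<in> {1, 2, 3}" "r \<noteq> s"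
      and eq: "coord r (star g) = coord r (circ h)" "coord s (star g) = coord s (circ h)" for g h r s
  proof -
    obtain u where u: "u \<in> U" "coord r (star g) = coord r u" "coord s (star g) = coord s u"
      by (rule latin_bitrade_mate[OF latin_bitrade_sym[OF U] g rs])
    obtain k where k: "k \<in> carrier G" "u = circ k"
      using u(1) sub by blast
    have "k = h"
      by (rule circ_eqI[OF k(1) h rs]) (use u(2,3) k(2) eq in simp_all)
    then show ?thesis
      using u(1) k(2) by simp
  qed
  have circ_self: "circ g \<in> U" if "star g \<in> U'" "g \<in> carrier G" for g
    using circ_mem[OF that, of 1 2] by (simp add: circ_def star_def)
  have star_self: "star g \<in> U'" if "circ g \<in> U" "g \<in> carrier G" for g
    using star_mem[OF that, of 1 2] by (simp add: circ_def star_def)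
  \<comment> \<open>Each move passes through \<open>U'\<close> in two steps, one keeping the index
    and the other shifting it.\<close>
  have step_a: "circ (g \<otimes> a) \<in> U" and step_inv_a: "circ (g \<otimes> inv a) \<in> U"
    and step_b: "circ (g \<otimes> b) \<in> U" and step_inv_b: "circ (g \<otimes> inv b) \<in> U"
    if g: "circ g \<in> U" "g \<in> carrier G" for g
  proof -
    have "star (g \<otimes> a) \<in> U'"
      using star_mem[OF g(1), of "g \<otimes> a" 1 3] g(2) by (simp add: star_a) (simp add: circ_def)
    then show "circ (g \<otimes> a) \<in> U"
      using circ_self g(2) by simp
    show "circ (g \<otimes> inv a) \<in> U"
      using circ_mem[OF star_self[OF g], of "g \<otimes> inv a" 1 3] g(2) by (simp add: circ_def star_def)
    show "circ (g \<otimes> b) \<in> U"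
      using circ_mem[OF star_self[OF g], of "g \<otimes> b" 2 3] g(2)
      by (simp add: circ_def star_conv_b)
    have "star (g \<otimes> inv b) \<in> U'"
      using star_mem[OF g(1), of "g \<otimes> inv b" 2 3] g(2) by (simp add: star_inv_b) (simp add: circ_def)
    then show "circ (g \<otimes> inv b) \<in> U"
      using circ_self g(2) by simp
  qed
  have c: "c = inv b \<otimes> inv a"
    using inv_c by (metis a_closed b_closed c_closed inv_inv inv_mult_group)
  \<comment> \<open>The quantifier over \<open>g\<close> is needed for products: \<open>h2\<close>
    is applied at the shifted index \<open>g \<otimes> h1\<close>.\<close>
  have closed: "\<forall>g\<in>carrier G. circ g \<in> U \<longrightarrow> circ (g \<otimes> x) \<in> U" if "x \<in> generate G {a, b, c}" for x
    using that
  proof (induction rule: generate.induct)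
    case one
    then show ?case
      by simp
  next
    case (incl h)
    then show ?case
      using step_a step_b step_inv_a step_inv_b by (auto simp: c simp flip: m_assoc)
  next
    case (inv h)
    then show ?case
      using step_a step_b step_inv_a step_inv_b by (auto simp: inv_c simp flip: m_assoc)
  next
    case (eng h1 h2)
    then have "h1 \<in> carrier G" "h2 \<in> carrier G"
      using generating by blast+
    then show ?case
      using eng.IH by (simp flip: m_assoc)
  qed
  obtain g where g: "g \<in> carrier G" "circ g \<in> U"
    using latin_bitrade_nonempty[OF U] sub by blast
  have "circ h \<in> U" if h: "h \<in> carrier G" for h
  proof -
    have "circ (g \<otimes> (inv g \<otimes> h)) \<in> U"
      using closed[of "inv g \<otimes> h"] g h generating by blast
    then show ?thesis
      using g h by (simp flip: m_assoc)
  qed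
  then show "U = circ ` carrier G"
    using sub by blast
qed

end

theorem lemma3p5:
  fixes G (structure) and a b c :: 'a and A B C :: "'a set"
    and T_circ T_star :: "('a set \<times> 'a set \<times> 'a set) set"
  assumes "group G" and "finite (carrier G)"
    and "a \<in> carrier G" and "b \<in> carrier G" and "c \<in> carrier G"
    and "a \<noteq> \<one>" and "b \<noteq> \<one>" and "c \<noteq> \<one>"
    and "A = generate G {a}" and "B = generate G {b}" and "C = generate G {c}"
    and "a \<otimes> b \<otimes> c = \<one>"
    and "card (A \<inter> B) = 1" and "card (A \<inter> C) = 1" and "card (B \<inter> C) = 1"
    and "carrier G = generate G {a, b, c}"
    and "T_circ = {(g <# A, g <# B, g <# C) | g. g \<in> carrier G}"
    and "T_star = {(g <# A, g <# B, (g \<otimes> inv a) <# C) | g. g \<in> carrier G}"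
  shows "latin_bitrade (lcosets A) (lcosets B) (lcosets C) T_circ T_star
    \<and> (thin_bitrade T_circ T_star \<longleftrightarrow>
        (\<forall>i j k :: int. a [^] i \<otimes> b [^] j \<otimes> c [^] k = \<one> \<longleftrightarrow>
            ([i = 0] (mod int (card A)) \<and> [j = 0] (mod int (card B)) \<and> [k = 0] (mod int (card C)))
          \<or> ([i = 1] (mod int (card A)) \<and> [j = 1] (mod int (card B)) \<and> [k = 1] (mod int (card C)))))
    \<and> (thin_bitrade T_circ T_star \<longrightarrow> minimal_latin_trade T_circ)"
proof -
  interpret group G by fact
  \<comment> \<open>Both generated subgroups contain \<open>\<one>\<close>, which must therefore be
    the single common element.\<close>
  have one: "H \<inter> K = {\<one>}" if "card (H \<inter> K) = 1" "H = generate G X" "K = generate G Y" for H K X Y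
    using that generate.one[of G] by (metis Int_iff card_1_singletonE singletonD)
  interpret bitrade_group G a b c A B C
    using assms(2-12,16) one[OF assms(13,9,10)] one[OF assms(14,9,11)] one[OF assms(15,10,11)]
    by unfold_locales auto
  have "T_circ = circ ` carrier G" "T_star = star ` carrier G"
    by (auto simp: assms(17,18) circ_def star_def)
  then show ?thesis
    using latin_bitrade_circ_star thin_bitrade_iff_int_pow minimal_latin_trade_circ by simp
qed

end
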